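(* Consider the contextual bilateral trade problem in the two-bit feedback model. There exists an efficiency-maximizing (i.e., gain-from-trade-maximizing) algorithm that achieves regret $O(d \log d)$ and enforces per-round budget balance.
   Context: Contextual bilateral trade: Let $\mathbb{B}=\{w\in\mathbb{R}^d:\|w\|_2\le 1\}$. There are two fixed vectors $s,b\in\mathbb{B}$ unknown to the learner. At each time $t=1,\dots,T$, the learner observes a context $x_t\in\mathbb{B}$ (the sequence of contexts, together with $s,b$, is fixed in advance by an oblivious adversary; this triple is an instance), and posts a price $p_t$ to the seller and $q_t$ to the buyer. The valuations are $s_t=\langle s,x_t\rangle$ and $b_t=\langle b,x_t\rangle$; the trade happens iff $s_t\le p_t$ and $q_t\le b_t$. Gain from trade: $\mathrm{GFT}_t(p_t,q_t)=(b_t-s_t)\,\mathbb{1}\{s_t\le p_t\}\mathbb{1}\{q_t\le b_t\}$. Profit: $\mathrm{Profit}_t(p_t,q_t)=(q_t-p_t)\,\mathbb{1}\{s_t\le p_t\}\mathbb{1}\{q_t\le b_t\}$. Two-bit feedback: after each round the learner observes $(\mathbb{1}\{s_t\le p_t\},\mathbb{1}\{q_t\le b_t\})$. The regret of a (possibly randomized) efficiency-maximizing algorithm $\mathcal{A}$ is $R_T(\mathcal{A})=\sup_{\mathcal{I}}\mathbb{E}\big[\sum_{t=1}^T (b_t-s_t)_+-\sum_{t=1}^T\mathrm{GFT}_t(p_t,q_t)\big]$, where the supremum is over instances and the expectation over the algorithm's randomness. Per-round budget balance means $p_t\le q_t$ for every $t$. The $O(\cdot)$ hides absolute constants (independent of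 $d$ and $T$). *)

theory Defs
  imports "HOL-Probability.Probability"
begin

text \<open>Vectors of R^d are represented as functions nat => real supported on {..<d}.\<close>

type_synonym vec = "nat \<Rightarrow> real"

definition ip :: "nat \<Rightarrow> vec \<Rightarrow> vec \<Rightarrow> real" where
  "ip d u v = (\<Sum>i<d. u i * v i)"

definition in_ball :: "nat \<Rightarrow> vec \<Rightarrow> bool" where
  "in_ball d v \<longleftrightarrow> (\<Sum>i<d. (v i)\<^sup>2) \<le> 1 \<and> (\<forall>i\<ge>d. v i = 0)"

text \<open>A history entry: (context, seller price p, buyer price q, seller bit, buyer bit).\<close>
type_synonym hist = "(vec \<times> real \<times> real \<times> bool \<times> bool) list"

type_synonym policy = "hist \<Rightarrow> vec \<Rightarrow> real \<times> real"

text \<open>History generated before round t (rounds are 0,...,T-1) on instance (s, b, x).\<close>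
fun history :: "nat \<Rightarrow> policy \<Rightarrow> vec \<Rightarrow> vec \<Rightarrow> (nat \<Rightarrow> vec) \<Rightarrow> nat \<Rightarrow> hist" where
  "history d pol s b x 0 = []"
| "history d pol s b x (Suc t) =
     (let h = history d pol s b x t; pq = pol h (x t)
      in h @ [(x t, fst pq, snd pq, ip d s (x t) \<le> fst pq, snd pq \<le> ip d b (x t))])"

definition prices :: "nat \<Rightarrow> policy \<Rightarrow> vec \<Rightarrow> vec \<Rightarrow> (nat \<Rightarrow> vec) \<Rightarrow> nat \<Rightarrow> real \<times> real" where
  "prices d pol s b x t = pol (history d pol s b x t) (x t)"

definition GFT :: "real \<Rightarrow> real \<Rightarrow> real \<Rightarrow> real \<Rightarrow> real" where
  "GFT st bt p q = (if st \<le> p \<and> q \<le> bt then bt - st else 0)"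

definition total_gft :: "nat \<Rightarrow> policy \<Rightarrow> vec \<Rightarrow> vec \<Rightarrow> (nat \<Rightarrow> vec) \<Rightarrow> nat \<Rightarrow> real" where
  "total_gft d pol s b x T =
     (\<Sum>t<T. GFT (ip d s (x t)) (ip d b (x t)) (fst (prices d pol s b x t)) (snd (prices d pol s b x t)))"

definition opt_gft :: "nat \<Rightarrow> vec \<Rightarrow> vec \<Rightarrow> (nat \<Rightarrow> vec) \<Rightarrow> nat \<Rightarrow> real" where
  "opt_gft d s b x T = (\<Sum>t<T. max 0 (ip d b (x t) - ip d s (x t)))"

definition valid_instance :: "nat \<Rightarrow> vec \<Rightarrow> vec \<Rightarrow> (nat \<Rightarrow> vec) \<Rightarrow> bool" where
  "valid_instance d s b x \<longleftrightarrow> in_ball d s \<and> in_ball d b \<and> (\<forall>t. in_ball d (x t))"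

text \<open>A randomized algorithm is a probability distribution over deterministic policies
  (all randomness drawn up front; adversary is oblivious).\<close>
definition regret_T :: "nat \<Rightarrow> policy pmf \<Rightarrow> vec \<Rightarrow> vec \<Rightarrow> (nat \<Rightarrow> vec) \<Rightarrow> nat \<Rightarrow> real" where
  "regret_T d A s b x T =
     opt_gft d s b x T - measure_pmf.expectation A (\<lambda>pol. total_gft d pol s b x T)"

definition budget_balanced :: "nat \<Rightarrow> policy pmf \<Rightarrow> bool" where
  "budget_balanced d A \<longleftrightarrow>
     (\<forall>pol\<in>set_pmf A. \<forall>s b x t. valid_instance d s b x \<longrightarrow>
        fst (prices d pol s b x t) \<le> snd (prices d pol s b x t))"

end

theory Submission
  imports Defs
begin

text \<open>
  The two parties are offered one common price, so each round yields a halfspace constraint on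
  both hidden vectors.  For every scale \<open>2\<^sup>-\<^sup>i\<close> consider the set of vectors satisfying all past
  constraints up to a slack \<open>r\<close> of order \<open>2\<^sup>-\<^sup>i / d\<close>; it always contains a cube of side \<open>2r/d\<close>
  around the hidden vector.  If some price separates the possible seller and buyer values, posting
  it costs nothing.  Otherwise take the coarsest scale at which one of the two sets is
  wide in the direction of the context: both sets are narrow one scale above, so the loss is
  \<open>O(2\<^sup>-\<^sup>i)\<close>, and a suitable price cuts a quarter off the volume of the wide set whatever the answer.
  Hence a scale is charged \<open>O(d (log d + i))\<close> times, and summing \<open>2\<^sup>-\<^sup>i d (log d + i)\<close> gives
  \<open>O(d log d)\<close>.
\<close>

section \<open>Lebesgue measure on d coordinates and its scaling under homotheties\<close>

text \<open>Points of this space are \<open>undefined\<close> from index \<open>d\<close> on,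
  whereas instance vectors are 0 there. Since \<open>ip d\<close> reads only the first
  \<open>d\<close> coordinates, the mismatch is bridged by restricting a vector to
  \<open>{..<d}\<close>.\<close>

definition vol :: "nat \<Rightarrow> (nat \<Rightarrow> real) measure" where
  "vol d = PiM {..<d} (\<lambda>_. lborel)"

lemma space_vol: "space (vol d) = extensional {..<d}"
  by (simp add: vol_def space_PiM PiE_def)

lemma measurable_component_vol [measurable]: "i < d \<Longrightarrow> (\<lambda>w. w i) \<in> borel_measurable (vol d)"
  unfolding vol_def using measurable_component_singleton[of i "{..<d}" "\<lambda>_. lborel"] by simp

lemma measurable_ip_vol [measurable]: "(\<lambda>w. ip d w x) \<in> borel_measurable (vol d)"
  unfolding ip_def by (intro borel_measurable_sum borel_measurable_times) auto

interpretation lborel_product: product_sigma_finite "\<lambda>_::nat. lborel :: real measure"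
  by standard

lemma emeasure_vol_PiE:
  assumes "\<And>i. i < d \<Longrightarrow> A i \<in> sets borel"
  shows "emeasure (vol d) (PiE {..<d} A) = (\<Prod>i<d. emeasure lborel (A i))"
  unfolding vol_def by (rule lborel_product.emeasure_PiM) (use assms in auto)

text \<open>For \<open>c\<close> in [0,1] the same map is a convex combination, so it serves both to
  express convexity and to scale volume.\<close>

definition homothety :: "nat \<Rightarrow> vec \<Rightarrow> real \<Rightarrow> vec \<Rightarrow> vec" where
  "homothety d z c w = (\<lambda>i\<in>{..<d}. (1 - c) * z i + c * w i)"

lemma homothety_in_space: "homothety d z c w \<in> space (vol d)"
  by (simp add: homothety_def space_vol)

lemma ip_homothety: "ip d (homothety d z c w) x = (1 - c) * ip d z x + c * ip d w x"
  by (simp add: ip_def homothety_def sum_distrib_left sum.distrib[symmetric] algebra_simps)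

lemma measurable_homothety [measurable]: "homothety d z c \<in> measurable (vol d) (vol d)"
proof -
  have "(\<lambda>w. \<lambda>i\<in>{..<d}. (1 - c) * z i + c * w i) \<in> measurable (vol d) (PiM {..<d} (\<lambda>_. lborel))"
    by (rule measurable_restrict) (simp, measurable)
  then show ?thesis by (simp add: homothety_def[abs_def] vol_def)
qed

lemma emeasure_lborel_affine_vimage:
  fixes c t :: real
  assumes "c > 0" "A \<in> sets borel"
  shows "ennreal c * emeasure lborel ((\<lambda>y. t + c * y) -` A) = emeasure lborel A"
proof -
  have "emeasure lborel A
      = emeasure (density (distr lborel borel (\<lambda>y. t + c * y)) (\<lambda>_. ennreal \<bar>c\<bar>)) A"
    using lborel_real_affine[of c t] assms by simp
  also have "\<dots> = ennreal c * emeasure (distr lborel borel (\<lambda>y. t + c * y)) A"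
    using assms by (subst emeasure_density) (auto simp: nn_integral_cmult)
  also have "\<dots> = ennreal c * emeasure lborel ((\<lambda>y. t + c * y) -` A)"
    using assms by (subst emeasure_distr) auto
  finally show ?thesis by simp
qed

text \<open>A product measure is determined by its values on boxes. The preimage of a box is again a
  box, and each side contributes one factor \<open>c\<close> by the one-dimensional affine change of
  variables.\<close>

lemma vol_eq_scale_distr_homothety:
  assumes "c > 0"
  shows "scale_measure (ennreal (c ^ d)) (distr (vol d) (vol d) (homothety d z c)) = vol d"
    (is "?N = _")
proof -
  have "?N = PiM {..<d} (\<lambda>_. lborel)"
  proof (rule lborel_product.PiM_eqI)
    show "finite {..<d}" by simp
    show "sets ?N = sets (PiM {..<d} (\<lambda>_. lborel))" by (simp add: vol_def)
    fix A :: "nat \<Rightarrow> real set" assume A: "\<And>i. i \<in> {..<d} \<Longrightarrow> A i \<in> sets lborel"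
    let ?B = "\<lambda>i. (\<lambda>y. (1 - c) * z i + c * y) -` A i"
    have B: "?B i \<in> sets borel" if "i < d" for i
    proof -
      have "?B i \<inter> space borel \<in> sets borel"
        by (rule measurable_sets[of _ _ borel]) (use A that in auto)
      then show ?thesis by simp
    qed
    have P: "PiE {..<d} A \<in> sets (vol d)"
      unfolding vol_def by (rule sets_PiM_I_finite) (use A in auto)
    have "homothety d z c -` PiE {..<d} A \<inter> space (vol d) = PiE {..<d} ?B"
      by (auto simp: homothety_def space_vol PiE_def Pi_def)
    then have "emeasure ?N (PiE {..<d} A) = ennreal (c ^ d) * (\<Prod>i<d. emeasure lborel (?B i))"
      using P B by (simp add: emeasure_distr emeasure_vol_PiE)
    also have "\<dots> = (\<Prod>i<d. ennreal c * emeasure lborel (?B i))"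
      using assms by (simp add: prod.distrib ennreal_power)
    also have "\<dots> = (\<Prod>i<d. emeasure lborel (A i))"
      by (rule prod.cong) (use A assms emeasure_lborel_affine_vimage in auto)
    finally show "emeasure ?N (PiE {..<d} A) = (\<Prod>i\<in>{..<d}. emeasure lborel (A i))" .
  qed
  then show ?thesis by (simp add: vol_def)
qed

text \<open>\<open>A\<close> lies in the preimage of \<open>B\<close>, whose volume is that of
  \<open>B\<close> divided by \<open>c ^ d\<close>. Finiteness of \<open>B\<close> matters because
  \<open>measure\<close> sends infinite volume to 0.\<close>

lemma measure_homothety_le:
  assumes "c > 0" and A: "A \<in> sets (vol d)" and B: "B \<in> sets (vol d)"
    and fin: "emeasure (vol d) B < \<infinity>"
    and sub: "\<And>w. w \<in> A \<Longrightarrow> homothety d z c w \<in> B"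
  shows "c ^ d * measure (vol d) A \<le> measure (vol d) B"
proof -
  let ?H = "homothety d z c -` B \<inter> space (vol d)"
  have H: "?H \<in> sets (vol d)" using B by measurable
  have "A \<subseteq> ?H" using sub sets.sets_into_space[OF A] by auto
  then have "ennreal (c ^ d) * emeasure (vol d) A \<le> ennreal (c ^ d) * emeasure (vol d) ?H"
    by (intro mult_left_mono emeasure_mono H) auto
  also have "\<dots> = emeasure (vol d) B"
    using arg_cong[OF vol_eq_scale_distr_homothety[OF assms(1), of d z], of "\<lambda>M. emeasure M B"] B
    by (simp add: emeasure_distr)
  finally have "enn2real (ennreal (c ^ d) * emeasure (vol d) A) \<le> enn2real (emeasure (vol d) B)"
    using fin by (intro enn2real_mono) auto
  then show ?thesis using assms(1) by (simp add: measure_def enn2real_mult)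
qed

lemma half_le_power_homothety_ratio:
  assumes "d \<ge> 1"
  shows "1 / 2 \<le> (1 - 1 / (2 * real d)) ^ d"
proof -
  have "1 + real d * (- 1 / (2 * real d)) \<le> (1 + (- 1 / (2 * real d))) ^ d"
    using assms by (intro Bernoulli_inequality) (auto simp: field_simps)
  then show ?thesis using assms by simp
qed

section \<open>Cutting a convex body with a margin\<close>

text \<open>Take the first grid value whose lower part holds half of the volume. Its predecessor
  \<open>a\<close> fails this, so the part above \<open>a\<close> holds at least half. Overlapping
  by one mesh \<open>r\<close> avoids any continuity argument for an exact median.\<close>

lemma ex_discrete_median:
  assumes K: "K \<in> sets (vol d)" and r: "r > 0"
    and bnd: "\<And>w. w \<in> K \<Longrightarrow> \<bar>ip d w x\<bar> \<le> B" and pos: "measure (vol d) K > 0"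
  obtains a where "measure (vol d) {w \<in> K. ip d w x \<le> a + r} \<ge> measure (vol d) K / 2"
    and "measure (vol d) {w \<in> K. a < ip d w x} \<ge> measure (vol d) K / 2"
proof -
  let ?m = "measure (vol d)"
  \<comment> \<open>The grid starts strictly below the range of \<open>ip d w x\<close> on
    \<open>K\<close>, so the lower part at index 0 is empty and the first good index has a
    predecessor.\<close>
  define y where "y n = - B - 1 + r * real n" for n :: nat
  define P where "P n \<longleftrightarrow> ?m {w \<in> K. ip d w x \<le> y n} \<ge> ?m K / 2" for n
  define n where "n = (LEAST n. P n)"
  obtain N :: nat where N: "(2 * B + 1) / r < real N" using reals_Archimedean2 by blast
  have "{w \<in> K. ip d w x \<le> y N} = K"
  proof -
    have "B \<le> y N" using N r by (simp add: y_def field_simps)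
    then show ?thesis using bnd by force
  qed
  then have "P N" using pos by (simp add: P_def)
  then have Pn: "P n" unfolding n_def by (rule LeastI)
  have "{w \<in> K. ip d w x \<le> y 0} = {}" using bnd by (force simp: y_def)
  then have "\<not> P 0" unfolding P_def using pos by (simp del: Collect_empty_eq)
  with Pn obtain k where k: "n = Suc k" by (cases n) auto
  then have nP: "\<not> P k" using not_less_Least[of k P] by (simp add: n_def)
  have S: "{w \<in> K. ip d w x \<le> y k} \<in> sets (vol d)" "{w \<in> K. y k < ip d w x} \<in> sets (vol d)"
    using K by measurable
  have "K = {w \<in> K. ip d w x \<le> y k} \<union> {w \<in> K. y k < ip d w x}" by auto
  then have "?m K = ?m ({w \<in> K. ip d w x \<le> y k} \<union> {w \<in> K. y k < ip d w x})" by simp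
  also have "\<dots> \<le> ?m {w \<in> K. ip d w x \<le> y k} + ?m {w \<in> K. y k < ip d w x}"
    by (intro measure_Un_le S)
  finally have "?m {w \<in> K. y k < ip d w x} \<ge> ?m K / 2" using nP by (simp add: P_def)
  moreover have "y n = y k + r" by (simp add: y_def k algebra_simps)
  ultimately show thesis using that[of "y k"] Pn by (simp add: P_def)
qed

text \<open>The two sets are what remains of \<open>K\<close> after either answer to price
  \<open>p\<close>, each answer being recorded with slack \<open>r\<close>. The slabs overlap, so a
  margin is needed beyond an ordinary halving.\<close>

definition balanced_cut :: "nat \<Rightarrow> vec set \<Rightarrow> vec \<Rightarrow> real \<Rightarrow> real \<Rightarrow> bool" where
  "balanced_cut d K x r p \<longleftrightarrow>
     measure (vol d) {w \<in> K. ip d w x \<le> p + r} \<le> 3 / 4 * measure (vol d) K \<and>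
     measure (vol d) {w \<in> K. p - r \<le> ip d w x} \<le> 3 / 4 * measure (vol d) K"

lemma measure_compl_le:
  assumes K: "K \<in> sets M" and fin: "emeasure M K < \<infinity>" and A: "A \<in> sets M" "A \<subseteq> K"
    and B: "B \<in> sets M" "B \<subseteq> K" "A \<inter> B = {}" and ge: "measure M B \<ge> measure M K / 4"
  shows "measure M A \<le> 3 / 4 * measure M K"
proof -
  have f: "emeasure M S \<noteq> \<infinity>" if "S \<subseteq> K" for S
    using emeasure_mono[OF that K] fin by (auto simp: top_unique)
  have "measure M A + measure M B = measure M (A \<union> B)"
    using A B f by (intro measure_Union[symmetric]) auto
  also have "\<dots> \<le> measure M K"
    using A B K fin by (intro measure_mono_fmeasurable) (auto simp: fmeasurable_def)
  finally show ?thesis using ge by simp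
qed

text \<open>A homothety of ratio \<open>1 - 1/(2d)\<close> centred at an extreme point costs at most half of the
  volume and pushes the half of \<open>K\<close> beyond the median past a margin of width comparable to
  \<open>1/d\<close> times the width of \<open>K\<close>.  A discrete median on a grid of mesh \<open>r\<close> suffices.\<close>

lemma ex_balanced_cut:
  assumes d: "d \<ge> 1" and K: "K \<in> sets (vol d)" and fin: "emeasure (vol d) K < \<infinity>" and r: "r > 0"
    and bnd: "\<And>w. w \<in> K \<Longrightarrow> \<bar>ip d w x\<bar> \<le> B" and pos: "measure (vol d) K > 0"
    and conv: "\<And>z w c. z \<in> K \<Longrightarrow> w \<in> K \<Longrightarrow> 0 \<le> c \<Longrightarrow> c \<le> 1 \<Longrightarrow> homothety d z c w \<in> K"
    and z: "z \<in> K" "z' \<in> K" "ip d z' x - ip d z x \<ge> 24 * real d * r"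
  shows "\<exists>p. balanced_cut d K x r p"
proof -
  let ?m = "measure (vol d)" and ?c = "1 - 1 / (2 * real d)"
  obtain a where lo: "?m {w \<in> K. ip d w x \<le> a + r} \<ge> ?m K / 2"
    and hi: "?m {w \<in> K. a < ip d w x} \<ge> ?m K / 2"
    using ex_discrete_median[OF K r bnd pos] by blast
  have S: "{w \<in> K. ip d w x \<le> y} \<in> sets (vol d)" "{w \<in> K. y < ip d w x} \<in> sets (vol d)"
    "{w \<in> K. y \<le> ip d w x} \<in> sets (vol d)" "{w \<in> K. ip d w x < y} \<in> sets (vol d)" for y
    using K by measurable
  have f: "emeasure (vol d) A < \<infinity>" if "A \<subseteq> K" for A
    using emeasure_mono[OF that K] fin by (auto simp: top_unique intro: le_less_trans)
  have c: "0 < ?c" "?c \<le> 1" using d by (auto simp: field_simps)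
  have quarter: "?m B \<ge> ?m K / 4"
    if "?m A \<ge> ?m K / 2" "A \<in> sets (vol d)" "B \<in> sets (vol d)" "B \<subseteq> K"
      "\<And>w. w \<in> A \<Longrightarrow> homothety d y ?c w \<in> B" for A B y
  proof -
    have "1 / 2 * (?m K / 2) \<le> ?c ^ d * ?m A"
      using that(1) half_le_power_homothety_ratio[OF d] c by (intro mult_mono) auto
    also have "\<dots> \<le> ?m B" using that c f by (intro measure_homothety_le) auto
    finally show ?thesis by simp
  qed
  have dr: "0 < d * r" using d r by simp
  \<comment> \<open>The two distances add up to more than 24dr, so they cannot both stay below 10dr.
    Contracting towards the far point then moves the median by about 10dr / (2d) = 5r.\<close>
  consider "ip d z' x - a \<ge> 10 * real d * r" | "a + r - ip d z x > 10 * real d * r"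
  proof (cases "ip d z' x - a \<ge> 10 * (real d * r)")
    case False
    have "0 < real d * r" using d r by simp
    then show ?thesis using False z(3) that(2) r by (simp add: mult.assoc)
  qed (use that(1) in simp)
  then show ?thesis
  proof cases
    case 1
    \<comment> \<open>To clear \<open>p + r\<close> the image must gain 4r over \<open>a\<close>,
      and 5r is available. Also \<open>p - r = a + 2 * r\<close> exceeds \<open>a + r\<close>, so
      the lower median half is disjoint from the slab left by the other answer.\<close>
    define p where "p = a + 3 * r"
    have "?m {w \<in> K. p + r < ip d w x} \<ge> ?m K / 4"
    proof (rule quarter[OF hi S(2) S(2)])
      fix w assume w: "w \<in> {w \<in> K. a < ip d w x}"
      have "4 * r < (ip d z' x - a) / (2 * real d)" using 1 d dr by (simp add: pos_less_divide_eq ac_simps)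
      also have "\<dots> = (1 - ?c) * (ip d z' x - a)" by simp
      finally have "p + r < (1 - ?c) * ip d z' x + ?c * a" by (simp add: p_def algebra_simps diff_divide_distrib)
      also have "\<dots> \<le> ip d (homothety d z' ?c w) x"
        using w c unfolding ip_homothety by (intro add_left_mono mult_left_mono) auto
      finally show "homothety d z' ?c w \<in> {w \<in> K. p + r < ip d w x}"
        using conv[OF z(2), of w ?c] w c by auto
    qed auto
    then have 1: "?m {w \<in> K. ip d w x \<le> p + r} \<le> 3 / 4 * ?m K"
      by (intro measure_compl_le[OF K fin S(1) _ S(2)]) auto
    have "?m {w \<in> K. ip d w x \<le> a + r} \<ge> ?m K / 4" using lo pos by linarith
    then have "?m {w \<in> K. p - r \<le> ip d w x} \<le> 3 / 4 * ?m K"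
      using r by (intro measure_compl_le[OF K fin S(3) _ S(1)]) (auto simp: p_def)
    with 1 show ?thesis unfolding balanced_cut_def by blast
  next
    case 2
    \<comment> \<open>Mirror image: the image must drop from \<open>a + r\<close> below
      \<open>p - r = a - 3 * r\<close>, again 4r, while \<open>p + r = a - r\<close> stays below the
      upper median half.\<close>
    define p where "p = a - 2 * r"
    have "?m {w \<in> K. ip d w x < p - r} \<ge> ?m K / 4"
    proof (rule quarter[OF lo S(1) S(4)])
      fix w assume w: "w \<in> {w \<in> K. ip d w x \<le> a + r}"
      have "ip d (homothety d z ?c w) x \<le> (1 - ?c) * ip d z x + ?c * (a + r)"
        using w c unfolding ip_homothety by (intro add_left_mono mult_left_mono) auto
      also have "\<dots> = a + r - (a + r - ip d z x) / (2 * real d)"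
        by (simp add: algebra_simps diff_divide_distrib add_divide_distrib)
      also have "\<dots> < p - r"
      proof -
        have "4 * r < (a + r - ip d z x) / (2 * real d)" using 2 d dr by (simp add: pos_less_divide_eq ac_simps)
        then show ?thesis by (simp add: p_def)
      qed
      finally show "homothety d z ?c w \<in> {w \<in> K. ip d w x < p - r}"
        using conv[OF z(1), of w ?c] w c by auto
    qed auto
    then have 1: "?m {w \<in> K. p - r \<le> ip d w x} \<le> 3 / 4 * ?m K"
      by (intro measure_compl_le[OF K fin S(3) _ S(4)]) auto
    have "?m {w \<in> K. a < ip d w x} \<ge> ?m K / 4" using hi pos by linarith
    then have "?m {w \<in> K. ip d w x \<le> p + r} \<le> 3 / 4 * ?m K"
      using r by (intro measure_compl_le[OF K fin S(1) _ S(2)]) (auto simp: p_def)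
    with 1 show ?thesis unfolding balanced_cut_def by blast
  qed
qed


section \<open>Vectors compatible with the past answers, and their volume\<close>

text \<open>The third component of a cut tells whether the hidden value lies below the price.\<close>

definition knowledge :: "nat \<Rightarrow> real \<Rightarrow> (vec \<times> real \<times> bool) list \<Rightarrow> vec set" where
  "knowledge d r cs = {w \<in> space (vol d). (\<Sum>i<d. (w i)\<^sup>2) \<le> 4 \<and>
     (\<forall>(x, p, below)\<in>set cs. if below then ip d w x \<le> p + r else p - r \<le> ip d w x)}"

text \<open>Both answers are kept as weak inequalities, so that the seller's bit (strict on refusal)
  and the buyer's bit (strict on refusal, in the other direction) fit one format.\<close>

definition consistent :: "nat \<Rightarrow> vec \<Rightarrow> (vec \<times> real \<times> bool) list \<Rightarrow> bool" where
  "consistent d v cs \<longleftrightarrow> in_ball d v \<and>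
     (\<forall>(x, p, below)\<in>set cs. in_ball d x \<and> (if below then ip d v x \<le> p else p \<le> ip d v x))"

lemma knowledge_Nil: "knowledge d r [] = {w \<in> space (vol d). (\<Sum>i<d. (w i)\<^sup>2) \<le> 4}"
  by (simp add: knowledge_def)

lemma knowledge_snoc:
  "knowledge d r (cs @ [(x, p, below)]) =
     (if below then {w \<in> knowledge d r cs. ip d w x \<le> p + r}
      else {w \<in> knowledge d r cs. p - r \<le> ip d w x})"
  by (auto simp: knowledge_def)

lemma sets_knowledge: "knowledge d r cs \<in> sets (vol d)"
proof (induction cs rule: rev_induct)
  case Nil
  have "{w \<in> space (vol d). (\<Sum>i<d. (w i)\<^sup>2) \<le> 4} \<in> sets (vol d)"
    by measurable
  then show ?case by (simp add: knowledge_Nil)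
next
  case (snoc c cs)
  obtain x p below where c: "c = (x, p, below)" by (cases c)
  have "{w \<in> knowledge d r cs. ip d w x \<le> p + r} \<in> sets (vol d)"
    "{w \<in> knowledge d r cs. p - r \<le> ip d w x} \<in> sets (vol d)"
    using snoc by measurable
  then show ?case by (simp add: c knowledge_snoc)
qed

lemma emeasure_knowledge_le: "emeasure (vol d) (knowledge d r cs) \<le> ennreal (4 ^ d)"
proof -
  have "knowledge d r cs \<subseteq> PiE {..<d} (\<lambda>_. {-2..2})"
  proof
    fix w assume w: "w \<in> knowledge d r cs"
    have "w i \<in> {-2..2}" if "i < d" for i
    proof -
      have "(w i)\<^sup>2 \<le> (\<Sum>i<d. (w i)\<^sup>2)" using that by (intro member_le_sum) auto
      then have "(w i)\<^sup>2 \<le> 2\<^sup>2" using w by (simp add: knowledge_def)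
      then have "\<bar>w i\<bar> \<le> 2" using abs_le_square_iff[of "w i" 2] by simp
      then show ?thesis by auto
    qed
    then show "w \<in> PiE {..<d} (\<lambda>_. {-2..2})"
      using w by (auto simp: knowledge_def space_vol PiE_def)
  qed
  moreover have "PiE {..<d} (\<lambda>_. {-2..2}) \<in> sets (vol d)"
    unfolding vol_def by (intro sets_PiM_I_finite) auto
  ultimately have "emeasure (vol d) (knowledge d r cs) \<le> emeasure (vol d) (PiE {..<d} (\<lambda>_. {-2..2}))"
    by (intro emeasure_mono)
  also have "\<dots> = ennreal (4 ^ d)" by (simp add: emeasure_vol_PiE flip: ennreal_power)
  finally show ?thesis .
qed

lemma emeasure_knowledge_finite: "emeasure (vol d) (knowledge d r cs) < \<infinity>"
  using le_less_trans[OF emeasure_knowledge_le] by simp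

lemma measure_knowledge_le: "measure (vol d) (knowledge d r cs) \<le> 4 ^ d"
  unfolding measure_def using enn2real_mono[OF emeasure_knowledge_le, of d r cs] by simp

text \<open>AM-GM in each coordinate gives (4 + 1) / 2. This is weaker than Cauchy-Schwarz but
  enough to bound every width by 5.\<close>

lemma ip_le:
  assumes "(\<Sum>i<d. (w i)\<^sup>2) \<le> 4" "in_ball d x"
  shows "\<bar>ip d w x\<bar> \<le> 5 / 2"
proof -
  have "\<bar>ip d w x\<bar> \<le> (\<Sum>i<d. \<bar>w i * x i\<bar>)" unfolding ip_def by (rule sum_abs)
  also have "\<dots> \<le> (\<Sum>i<d. ((w i)\<^sup>2 + (x i)\<^sup>2) / 2)"
  proof (rule sum_mono)
    fix i
    show "\<bar>w i * x i\<bar> \<le> ((w i)\<^sup>2 + (x i)\<^sup>2) / 2"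
      using sum_squares_bound[of "\<bar>w i\<bar>" "\<bar>x i\<bar>"] by (simp add: abs_mult)
  qed
  also have "\<dots> \<le> 5 / 2"
    using assms by (simp add: in_ball_def sum.distrib flip: sum_divide_distrib)
  finally show ?thesis .
qed

lemma homothety_in_knowledge:
  assumes z: "z \<in> knowledge d r cs" and w: "w \<in> knowledge d r cs" and c: "0 \<le> c" "c \<le> 1"
  shows "homothety d z c w \<in> knowledge d r cs"
proof -
  have "(\<Sum>i<d. (homothety d z c w i)\<^sup>2) \<le> (\<Sum>i<d. (1 - c) * (z i)\<^sup>2 + c * (w i)\<^sup>2)"
  proof (rule sum_mono)
    fix i assume "i \<in> {..<d}"
    \<comment> \<open>This is exactly the convexity defect of the square: right side minus left side
      of the next inequality.\<close>
    have "0 \<le> c * (1 - c) * (z i - w i)\<^sup>2" using c by simp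
    then show "(homothety d z c w i)\<^sup>2 \<le> (1 - c) * (z i)\<^sup>2 + c * (w i)\<^sup>2"
      using \<open>i \<in> _\<close> by (simp add: homothety_def algebra_simps power2_eq_square)
  qed
  also have "\<dots> = (1 - c) * (\<Sum>i<d. (z i)\<^sup>2) + c * (\<Sum>i<d. (w i)\<^sup>2)"
    by (simp add: sum.distrib sum_distrib_left)
  also have "\<dots> \<le> 4" by (rule convex_bound_le) (use z w c in \<open>auto simp: knowledge_def\<close>)
  finally have 1: "(\<Sum>i<d. (homothety d z c w i)\<^sup>2) \<le> 4" .
  have "if below then ip d (homothety d z c w) x \<le> p + r else p - r \<le> ip d (homothety d z c w) x"
    if "(x, p, below) \<in> set cs" for x p below
  proof (cases below)
    case True
    then have "ip d z x \<le> p + r" "ip d w x \<le> p + r"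
      using z w that by (fastforce simp: knowledge_def)+
    then show ?thesis using True c by (auto simp: ip_homothety intro!: convex_bound_le)
  next
    case False
    then have "- ip d z x \<le> r - p" "- ip d w x \<le> r - p"
      using z w that by (fastforce simp: knowledge_def)+
    then have "(1 - c) * (- ip d z x) + c * (- ip d w x) \<le> r - p"
      using c by (intro convex_bound_le) auto
    then show ?thesis using False by (simp add: ip_homothety)
  qed
  with 1 show ?thesis using homothety_in_space by (auto simp: knowledge_def)
qed

text \<open>Coordinates of a context are at most 1 in absolute value, so moving each coordinate of
  \<open>v\<close> by \<open>r / d\<close> changes an inner product by at most \<open>r\<close>,
  which the slack absorbs. The radius 2 in \<open>knowledge\<close> leaves room for the cube around
  any \<open>v\<close> in the unit ball.\<close>

lemma cube_subset_knowledge: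
  assumes d: "d \<ge> 1" and v: "consistent d v cs" and r: "0 < r" "r \<le> 1"
  shows "PiE {..<d} (\<lambda>i. {v i - r / d .. v i + r / d}) \<subseteq> knowledge d r cs"
proof
  fix w assume w: "w \<in> PiE {..<d} (\<lambda>i. {v i - r / d .. v i + r / d})"
  have diff: "\<bar>w i - v i\<bar> \<le> r / d" if "i < d" for i
  proof -
    have "w i \<in> {v i - r / d .. v i + r / d}" using w that by (auto simp: PiE_def Pi_def)
    then show ?thesis by (auto simp: abs_le_iff)
  qed
  have "(\<Sum>i<d. (w i)\<^sup>2) \<le> (\<Sum>i<d. 2 * (v i)\<^sup>2 + 2 / d)"
  proof (rule sum_mono)
    fix i assume "i \<in> {..<d}"
    then have "\<bar>w i - v i\<bar> \<le> 1 / d" using diff[of i] r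
      by (meson divide_right_mono lessThan_iff of_nat_0_le_iff order_trans)
    then have "(w i - v i)\<^sup>2 \<le> (1 / d)\<^sup>2" by (simp add: abs_le_square_iff[symmetric])
    also have "\<dots> \<le> 1 / d"
    proof -
      have "(1 / real d)\<^sup>2 = (1 / real d) * (1 / real d)" by (simp add: power2_eq_square)
      also have "\<dots> \<le> (1 / real d) * 1" using d by (intro mult_left_mono) auto
      finally show ?thesis by simp
    qed
    finally have "(w i - v i)\<^sup>2 \<le> 1 / d" .
    \<comment> \<open>The right side minus the left side equals
      \<open>(w i - 2 * v i)\<^sup>2\<close>.\<close>
    moreover have "(w i)\<^sup>2 \<le> 2 * (v i)\<^sup>2 + 2 * (w i - v i)\<^sup>2"
      using zero_le_power2[of "w i - 2 * v i"] by (simp add: power2_eq_square algebra_simps)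
    ultimately show "(w i)\<^sup>2 \<le> 2 * (v i)\<^sup>2 + 2 / d" by (simp add: field_simps)
  qed
  also have "\<dots> \<le> 4"
    using v d by (simp add: consistent_def in_ball_def sum.distrib flip: sum_distrib_left)
  finally have 1: "(\<Sum>i<d. (w i)\<^sup>2) \<le> 4" .
  have ipd: "\<bar>ip d w x - ip d v x\<bar> \<le> r" if "in_ball d x" for x
  proof -
    have "ip d w x - ip d v x = (\<Sum>i<d. (w i - v i) * x i)"
      by (simp add: ip_def sum_subtractf left_diff_distrib)
    then have "\<bar>ip d w x - ip d v x\<bar> \<le> (\<Sum>i<d. \<bar>(w i - v i) * x i\<bar>)" by simp
    also have "\<dots> \<le> (\<Sum>i<d. r / d * 1)"
    proof (rule sum_mono)
      fix i assume i: "i \<in> {..<d}"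
      have "(x i)\<^sup>2 \<le> (\<Sum>i<d. (x i)\<^sup>2)" using i by (intro member_le_sum) auto
      then have "\<bar>x i\<bar> \<le> 1" using that by (simp add: in_ball_def abs_square_le_1[symmetric])
      then show "\<bar>(w i - v i) * x i\<bar> \<le> r / d * 1"
        unfolding abs_mult using diff i r by (intro mult_mono) auto
    qed
    also have "\<dots> = r" using d by simp
    finally show ?thesis .
  qed
  have "if below then ip d w x \<le> p + r else p - r \<le> ip d w x" if "(x, p, below) \<in> set cs" for x p below
  proof -
    have "in_ball d x" "if below then ip d v x \<le> p else p \<le> ip d v x"
      using v that by (auto simp: consistent_def)
    then show ?thesis using ipd[of x] by (auto split: if_splits)
  qed
  with 1 show "w \<in> knowledge d r cs" using w by (auto simp: knowledge_def space_vol PiE_def)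
qed

text \<open>This floor on the volume limits how many balanced cuts a scale can undergo.\<close>

lemma measure_knowledge_ge:
  assumes d: "d \<ge> 1" and v: "consistent d v cs" and r: "0 < r" "r \<le> 1"
  shows "(2 * r / d) ^ d \<le> measure (vol d) (knowledge d r cs)"
proof -
  have "(2 * r / d) ^ d = measure (vol d) (PiE {..<d} (\<lambda>i. {v i - r / d .. v i + r / d}))"
    using r by (simp add: measure_def emeasure_vol_PiE ennreal_power)
  also have "\<dots> \<le> measure (vol d) (knowledge d r cs)"
  proof (rule measure_mono_fmeasurable)
    show "PiE {..<d} (\<lambda>i. {v i - r / d .. v i + r / d}) \<in> sets (vol d)"
      unfolding vol_def by (intro sets_PiM_I_finite) auto
    show "knowledge d r cs \<in> fmeasurable (vol d)"
      using sets_knowledge emeasure_knowledge_finite by (simp add: fmeasurable_def)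
  qed (rule cube_subset_knowledge[OF assms])
  finally show ?thesis .
qed

lemma measure_knowledge_pos:
  assumes "d \<ge> 1" "consistent d v cs" "0 < r" "r \<le> 1"
  shows "0 < measure (vol d) (knowledge d r cs)"
proof -
  have "0 < (2 * r / d) ^ d" using assms by simp
  then show ?thesis using measure_knowledge_ge[OF assms] by linarith
qed

text \<open>The hidden vector itself need not be extensional, so its restriction stands in for it,
  with the same inner products.\<close>

lemma consistent_in_knowledge:
  assumes "d \<ge> 1" "consistent d v cs" "0 < r" "r \<le> 1"
  shows "\<exists>w \<in> knowledge d r cs. \<forall>x. ip d w x = ip d v x"
proof
  show "restrict v {..<d} \<in> knowledge d r cs"
    using assms(3) by (intro subsetD[OF cube_subset_knowledge[OF assms]]) auto
qed (simp add: ip_def)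

lemma measure_knowledge_snoc_le:
  "measure (vol d) (knowledge d r (cs @ [c])) \<le> measure (vol d) (knowledge d r cs)"
proof (rule measure_mono_fmeasurable)
  show "knowledge d r cs \<in> fmeasurable (vol d)"
    using sets_knowledge emeasure_knowledge_finite by (simp add: fmeasurable_def)
qed (auto simp: knowledge_def sets_knowledge)

lemma measure_knowledge_snoc_balanced:
  assumes "balanced_cut d (knowledge d r cs) x r p"
  shows "measure (vol d) (knowledge d r (cs @ [(x, p, below)])) \<le> 3 / 4 * measure (vol d) (knowledge d r cs)"
  using assms by (simp add: knowledge_snoc balanced_cut_def)

section \<open>Scales and width along a context\<close>

text \<open>The factor 8 exceeds the maximal width 5 from \<open>ip_le\<close>, so no set is wide at
  scale 0 and every wide scale has a coarser neighbour.\<close>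

definition width_scale :: "nat \<Rightarrow> real" where
  "width_scale i = 8 / 2 ^ i"

text \<open>Chosen so that \<open>24 * d * slack d i\<close> equals \<open>width_scale i\<close>,
  the width demanded by \<open>ex_balanced_cut\<close>.\<close>

definition slack :: "nat \<Rightarrow> nat \<Rightarrow> real" where
  "slack d i = width_scale i / (24 * real d)"

lemma width_scale_pos: "0 < width_scale i"
  by (simp add: width_scale_def)

lemma slack_pos: "d \<ge> 1 \<Longrightarrow> 0 < slack d i"
  by (simp add: slack_def width_scale_pos)

lemma slack_le_1:
  assumes "d \<ge> 1"
  shows "slack d i \<le> 1"
proof -
  have "width_scale i \<le> 8" by (simp add: width_scale_def field_simps)
  then show ?thesis using assms by (simp add: slack_def field_simps)
qed

definition wide :: "nat \<Rightarrow> nat \<Rightarrow> (vec \<times> real \<times> bool) list \<Rightarrow> vec \<Rightarrow> bool" where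
  "wide d i cs x \<longleftrightarrow>
     (\<exists>z\<in>knowledge d (slack d i) cs. \<exists>z'\<in>knowledge d (slack d i) cs. width_scale i \<le> ip d z' x - ip d z x)"

lemma not_wide_0:
  assumes "in_ball d x"
  shows "\<not> wide d 0 cs x"
proof
  assume "wide d 0 cs x"
  then obtain z z' where "z \<in> knowledge d (slack d 0) cs" "z' \<in> knowledge d (slack d 0) cs"
    "8 \<le> ip d z' x - ip d z x" by (auto simp: wide_def width_scale_def)
  then show False using ip_le[of z d x] ip_le[of z' d x] assms by (auto simp: knowledge_def)
qed

lemma wide_ex_balanced_cut:
  assumes d: "d \<ge> 1" and v: "consistent d v cs" and x: "in_ball d x" and wide: "wide d i cs x"
  shows "\<exists>p. balanced_cut d (knowledge d (slack d i) cs) x (slack d i) p"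
proof -
  obtain z z' where z: "z \<in> knowledge d (slack d i) cs" "z' \<in> knowledge d (slack d i) cs"
    "width_scale i \<le> ip d z' x - ip d z x" using wide by (auto simp: wide_def)
  show ?thesis
  proof (rule ex_balanced_cut[OF d sets_knowledge emeasure_knowledge_finite slack_pos[OF d]])
    show "\<bar>ip d w x\<bar> \<le> 5 / 2" if "w \<in> knowledge d (slack d i) cs" for w
      using that x by (intro ip_le) (auto simp: knowledge_def)
    show "24 * real d * slack d i \<le> ip d z' x - ip d z x" using z(3) d by (simp add: slack_def)
  qed (use z homothety_in_knowledge measure_knowledge_pos[OF d v slack_pos slack_le_1] d in auto)
qed

lemma not_wide_bounds:
  assumes d: "d \<ge> 1" and v: "consistent d v cs" and "\<not> wide d i cs x"
    and w: "w \<in> knowledge d (slack d i) cs"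
  shows "\<bar>ip d w x - ip d v x\<bar> < width_scale i"
proof -
  obtain u where "u \<in> knowledge d (slack d i) cs" "ip d u x = ip d v x"
    using consistent_in_knowledge[OF d v slack_pos slack_le_1] d by blast
  then show ?thesis using assms(3) w unfolding wide_def abs_less_iff by fastforce
qed

section \<open>The trading policy\<close>

definition seller_cuts :: "hist \<Rightarrow> (vec \<times> real \<times> bool) list" where
  "seller_cuts = map (\<lambda>(x, p, q, accept_s, accept_b). (x, p, accept_s))"

text \<open>The bit is negated because a buyer accepts when the value is at or above the
  price.\<close>

definition buyer_cuts :: "hist \<Rightarrow> (vec \<times> real \<times> bool) list" where
  "buyer_cuts = map (\<lambda>(x, p, q, accept_s, accept_b). (x, q, \<not> accept_b))"

definition separating :: "nat \<Rightarrow> hist \<Rightarrow> vec \<Rightarrow> real \<Rightarrow> bool" where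
  "separating d h x p \<longleftrightarrow>
     (\<exists>i. (\<forall>w\<in>knowledge d (slack d i) (seller_cuts h). ip d w x \<le> p) \<and>
          (\<forall>w\<in>knowledge d (slack d i) (buyer_cuts h). p \<le> ip d w x))"

text \<open>The value is unspecified when no scale is wide. Positive loss excludes that case, so it
  never enters the analysis.\<close>

definition level :: "nat \<Rightarrow> hist \<Rightarrow> vec \<Rightarrow> nat" where
  "level d h x = (LEAST i. wide d i (seller_cuts h) x \<or> wide d i (buyer_cuts h) x)"

definition trade_price :: "nat \<Rightarrow> hist \<Rightarrow> vec \<Rightarrow> real" where
  "trade_price d h x =
     (if \<exists>p. separating d h x p then SOME p. separating d h x p
      else let i = level d h x; cs = (if wide d i (seller_cuts h) x then seller_cuts h else buyer_cuts h)
        in SOME p. balanced_cut d (knowledge d (slack d i) cs) x (slack d i) p)"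

definition trade_policy :: "nat \<Rightarrow> policy" where
  "trade_policy d h x = (trade_price d h x, trade_price d h x)"

lemma consistent_history:
  assumes "valid_instance d s b x"
  shows "consistent d s (seller_cuts (history d pol s b x t))"
    and "consistent d b (buyer_cuts (history d pol s b x t))"
  using assms
  by (induction t) (auto simp: consistent_def seller_cuts_def buyer_cuts_def valid_instance_def Let_def)

text \<open>Every candidate seller value is within one width of the true one, and likewise for the
  buyer, so a gap of two widths leaves room between them. The price depends on hidden data, but only
  its existence matters; the contrapositive bounds the gap when nothing separates.\<close>

lemma separatingI:
  assumes d: "d \<ge> 1" and s: "consistent d s (seller_cuts h)" and b: "consistent d b (buyer_cuts h)"
    and nw: "\<not> wide d i (seller_cuts h) x" "\<not> wide d i (buyer_cuts h) x"
    and gap: "2 * width_scale i \<le> ip d b x - ip d s x"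
  shows "separating d h x (ip d s x + width_scale i)"
  unfolding separating_def
proof (intro exI[of _ i] conjI ballI)
  show "ip d w x \<le> ip d s x + width_scale i" if "w \<in> knowledge d (slack d i) (seller_cuts h)" for w
    using not_wide_bounds[OF d s nw(1) that] by linarith
  show "ip d s x + width_scale i \<le> ip d w x" if "w \<in> knowledge d (slack d i) (buyer_cuts h)" for w
    using not_wide_bounds[OF d b nw(2) that] gap by linarith
qed

section \<open>Charging loss to the decrease of volume\<close>

text \<open>The potential of scale \<open>i\<close>. Both parties are added because a charged round
  is only guaranteed to shrink one of the two sets, while the other cannot grow.\<close>

definition log_vol :: "nat \<Rightarrow> hist \<Rightarrow> nat \<Rightarrow> real" where
  "log_vol d h i = ln (measure (vol d) (knowledge d (slack d i) (seller_cuts h)))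
     + ln (measure (vol d) (knowledge d (slack d i) (buyer_cuts h)))"

definition loss :: "nat \<Rightarrow> vec \<Rightarrow> vec \<Rightarrow> (nat \<Rightarrow> vec) \<Rightarrow> nat \<Rightarrow> real" where
  "loss d s b x t = max 0 (ip d b (x t) - ip d s (x t))
     - GFT (ip d s (x t)) (ip d b (x t)) (fst (prices d (trade_policy d) s b x t)) (snd (prices d (trade_policy d) s b x t))"

lemma ln_measure_knowledge_snoc:
  assumes d: "d \<ge> 1" and v: "consistent d v (cs @ [c])"
  shows "ln (measure (vol d) (knowledge d (slack d i) (cs @ [c]))) \<le> ln (measure (vol d) (knowledge d (slack d i) cs))"
  using measure_knowledge_snoc_le measure_knowledge_pos[OF d v slack_pos slack_le_1] d
  by (meson less_le_trans ln_le_cancel_iff)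

lemma ln_measure_knowledge_snoc_balanced:
  assumes d: "d \<ge> 1" and v: "consistent d v (cs @ [(x, p, below)])"
    and cut: "balanced_cut d (knowledge d (slack d i) cs) x (slack d i) p"
  shows "ln (measure (vol d) (knowledge d (slack d i) (cs @ [(x, p, below)])))
    \<le> ln (measure (vol d) (knowledge d (slack d i) cs)) - ln (4 / 3)"
proof -
  let ?m = "measure (vol d) (knowledge d (slack d i) cs)"
    and ?m' = "measure (vol d) (knowledge d (slack d i) (cs @ [(x, p, below)]))"
  have pos: "0 < ?m'" using measure_knowledge_pos[OF d v slack_pos slack_le_1] d by blast
  have le: "?m' \<le> 3 / 4 * ?m" by (rule measure_knowledge_snoc_balanced[OF cut])
  have "ln ?m' \<le> ln (?m / (4 / 3))" using pos le by (subst ln_le_cancel_iff) auto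
  also have "\<dots> = ln ?m - ln (4 / 3)" using pos le by (subst ln_div) auto
  finally show ?thesis .
qed

lemma log_vol_history_le:
  assumes d: "d \<ge> 1" and inst: "valid_instance d s b x"
  shows "log_vol d (history d pol s b x (Suc t)) i \<le> log_vol d (history d pol s b x t) i"
  using consistent_history[OF inst, of pol "Suc t"]
  by (auto simp: log_vol_def Let_def seller_cuts_def buyer_cuts_def
      intro!: add_mono ln_measure_knowledge_snoc[OF d])

text \<open>Positive loss means no separating price existed. The scale just coarser than the level
  is then narrow for both parties, which bounds the gap, and the posted price is a balanced cut for
  a wide party.\<close>

lemma loss_le_log_vol_decrease:
  assumes d: "d \<ge> 1" and inst: "valid_instance d s b x"
  defines "h \<equiv> history d (trade_policy d) s b x"
  shows "loss d s b x t \<le> 0 \<or>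
    (let i = level d (h t) (x t) in
      loss d s b x t \<le> 4 * width_scale i \<and> log_vol d (h (Suc t)) i \<le> log_vol d (h t) i - ln (4 / 3))"
proof (cases "loss d s b x t \<le> 0")
  case False
  let ?s = "ip d s (x t)" and ?b = "ip d b (x t)" and ?p = "trade_price d (h t) (x t)"
  let ?W = "\<lambda>i. wide d i (seller_cuts (h t)) (x t) \<or> wide d i (buyer_cuts (h t)) (x t)"
  define i where "i = level d (h t) (x t)"
  have pr: "prices d (trade_policy d) s b x t = (?p, ?p)"
    by (simp add: prices_def trade_policy_def h_def)
  have lt: "?s < ?b" and nt: "\<not> (?s \<le> ?p \<and> ?p \<le> ?b)" and loss: "loss d s b x t = ?b - ?s"
    using False by (auto simp: loss_def pr GFT_def max_def split: if_splits)
  have cs: "consistent d s (seller_cuts (h t))" "consistent d b (buyer_cuts (h t))"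
    using consistent_history[OF inst] by (auto simp: h_def)
  have xt: "in_ball d (x t)" using inst by (simp add: valid_instance_def)
  \<comment> \<open>A separating price would have been posted and accepted by both parties, as each
    set contains a copy of the hidden vector.\<close>
  have nsep: "\<not> separating d (h t) (x t) p" for p
  proof
    assume "separating d (h t) (x t) p"
    then have "separating d (h t) (x t) ?p"
      unfolding trade_price_def by (auto intro: someI)
    then obtain j where j: "\<forall>w\<in>knowledge d (slack d j) (seller_cuts (h t)). ip d w (x t) \<le> ?p"
      "\<forall>w\<in>knowledge d (slack d j) (buyer_cuts (h t)). ?p \<le> ip d w (x t)"
      by (auto simp: separating_def)
    then have "?s \<le> ?p" "?p \<le> ?b"
      using consistent_in_knowledge[OF d cs(1) slack_pos slack_le_1, OF d d, of j]
        consistent_in_knowledge[OF d cs(2) slack_pos slack_le_1, OF d d, of j] by metis+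
    then show False using nt by simp
  qed
  have narrow: "?b - ?s < 2 * width_scale j" if "\<not> ?W j" for j
    using separatingI[OF d cs, of j "x t"] that nsep by force
  \<comment> \<open>If all scales were narrow, the gap would be below 16 / 2^j for every
    \<open>j\<close>, contradicting \<open>lt\<close>.\<close>
  have "\<exists>j. ?W j"
  proof (rule ccontr)
    assume "\<nexists>j. ?W j"
    then have "?b - ?s < 16 / 2 ^ j" for j using narrow[of j] by (simp add: width_scale_def)
    moreover obtain j where "16 / (?b - ?s) < 2 ^ j" using real_arch_pow[of 2 "16 / (?b - ?s)"] by auto
    ultimately show False using lt by (auto simp: field_simps not_less less_imp_le)
       (smt (verit))
  qed
  then have W: "?W i" unfolding i_def level_def by (rule LeastI_ex)
  then have "i \<noteq> 0" using not_wide_0[OF xt] by metis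
  then obtain k where k: "i = Suc k" by (cases i) auto
  then have "\<not> ?W k" using not_less_Least[of k ?W] by (simp add: i_def level_def)
  \<comment> \<open>Two widths of scale \<open>k\<close> are four widths of scale
    \<open>i = Suc k\<close>.\<close>
  from narrow[OF this] have le: "loss d s b x t \<le> 4 * width_scale i" by (simp add: loss k width_scale_def)
  have step: "h (Suc t) = h t @ [(x t, ?p, ?p, ?s \<le> ?p, ?p \<le> ?b)]"
    by (simp add: h_def Let_def trade_policy_def)
  have cs': "consistent d s (seller_cuts (h t) @ [(x t, ?p, ?s \<le> ?p)])"
    "consistent d b (buyer_cuts (h t) @ [(x t, ?p, \<not> ?p \<le> ?b)])"
    using consistent_history[OF inst, of "trade_policy d" "Suc t", folded h_def] step
    by (auto simp: seller_cuts_def buyer_cuts_def)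
  have lv: "log_vol d (h (Suc t)) i =
      ln (measure (vol d) (knowledge d (slack d i) (seller_cuts (h t) @ [(x t, ?p, ?s \<le> ?p)])))
    + ln (measure (vol d) (knowledge d (slack d i) (buyer_cuts (h t) @ [(x t, ?p, \<not> ?p \<le> ?b)])))"
    by (simp add: log_vol_def step seller_cuts_def buyer_cuts_def)
  have "log_vol d (h (Suc t)) i \<le> log_vol d (h t) i - ln (4 / 3)"
  proof (cases "wide d i (seller_cuts (h t)) (x t)")
    case True
    have "balanced_cut d (knowledge d (slack d i) (seller_cuts (h t))) (x t) (slack d i) ?p"
      using someI_ex[OF wide_ex_balanced_cut[OF d cs(1) xt True]] nsep True
      by (simp add: trade_price_def Let_def flip: i_def)
    from ln_measure_knowledge_snoc_balanced[OF d cs'(1) this] ln_measure_knowledge_snoc[OF d cs'(2), of i]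
    show ?thesis unfolding lv log_vol_def[of d "h t"] by linarith
  next
    case False
    then have wb: "wide d i (buyer_cuts (h t)) (x t)" using W by blast
    have "balanced_cut d (knowledge d (slack d i) (buyer_cuts (h t))) (x t) (slack d i) ?p"
      using someI_ex[OF wide_ex_balanced_cut[OF d cs(2) xt wb]] nsep False
      by (simp add: trade_price_def Let_def flip: i_def)
    from ln_measure_knowledge_snoc_balanced[OF d cs'(2) this] ln_measure_knowledge_snoc[OF d cs'(1), of i]
    show ?thesis unfolding lv log_vol_def[of d "h t"] by linarith
  qed
  with le show ?thesis by (simp add: i_def Let_def)
qed simp

section \<open>Summation over rounds and scales\<close>

text \<open>Each volume starts at most at 4^d, from an enclosing cube, and never falls below that of
  the inscribed cube of side \<open>2 * slack d i / d\<close>. The factor 2 counts the two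
  parties.\<close>

lemma log_vol_total_decrease_le:
  assumes d: "d \<ge> 1" and inst: "valid_instance d s b x"
  shows "log_vol d [] i - log_vol d (history d pol s b x T) i
    \<le> 2 * real d * ln (real d + 1) * (5 + real i)"
proof -
  let ?h = "history d pol s b x T" and ?l = "2 * slack d i / d"
  note sl = slack_pos[OF d, of i] slack_le_1[OF d, of i]
  have nil: "consistent d s []" using inst by (simp add: consistent_def valid_instance_def)
  have up: "ln (measure (vol d) (knowledge d (slack d i) [])) \<le> d * ln 4"
  proof -
    have "ln (measure (vol d) (knowledge d (slack d i) [])) \<le> ln (4 ^ d)"
      using measure_knowledge_pos[OF d nil sl] measure_knowledge_le by (subst ln_le_cancel_iff) auto
    then show ?thesis by (simp add: ln_realpow)
  qed
  have lo: "d * ln ?l \<le> ln (measure (vol d) (knowledge d (slack d i) cs))" if "consistent d v cs" for v cs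
  proof -
    have "0 < ?l" using sl d by simp
    then have "ln (?l ^ d) \<le> ln (measure (vol d) (knowledge d (slack d i) cs))"
      using measure_knowledge_pos[OF d that sl] measure_knowledge_ge[OF d that sl]
      by (subst ln_le_cancel_iff) auto
    then show ?thesis using \<open>0 < ?l\<close> by (simp add: ln_realpow)
  qed
  have l: "?l = (2 / 3) / (real d ^ 2 * 2 ^ i)"
    using d by (simp add: slack_def width_scale_def power2_eq_square field_simps)
  have "log_vol d [] i - log_vol d ?h i \<le> 2 * (d * ln 4) - 2 * (d * ln ?l)"
    using up lo[OF consistent_history(1)[OF inst]] lo[OF consistent_history(2)[OF inst]]
    unfolding log_vol_def by (simp add: seller_cuts_def buyer_cuts_def) (smt (verit))
  also have "\<dots> = 2 * d * (ln 4 - ln ?l)" by (simp add: algebra_simps)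
  also have "ln 4 - ln ?l = ln 6 + 2 * ln d + i * ln 2"
  proof -
    have "ln ?l = ln (2 / 3) - (2 * ln d + i * ln 2)"
      unfolding l using d by (simp add: ln_div ln_mult ln_realpow)
    moreover have "ln (6::real) = ln 4 - ln (2 / 3)" using ln_div[of 4 "2 / 3 :: real"] by simp
    ultimately show ?thesis by simp
  qed
  \<comment> \<open>Every term is absorbed using \<open>ln 2 \<le> ln (real d + 1)\<close>, valid
    already for \<open>d = 1\<close>; the constant term uses 6 <= 2^3.\<close>
  also have "2 * d * \<dots> \<le> 2 * d * (3 * ln (real d + 1) + 2 * ln (real d + 1) + i * ln (real d + 1))"
  proof (intro mult_left_mono add_mono)
    have "ln 2 \<le> ln (real d + 1)" using d by simp
    have "ln (6::real) \<le> ln (2 ^ 3)" by (subst ln_le_cancel_iff) auto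
    also have "\<dots> = 3 * ln 2" by (subst ln_realpow) auto
    also have "\<dots> \<le> 3 * ln (real d + 1)" using d by simp
    finally show "ln 6 \<le> 3 * ln (real d + 1)" .
  qed (use d in auto)
  finally show ?thesis by (simp add: algebra_simps)
qed

text \<open>The full series is 8 * (5 * 2 + 2) = 96; the induction carries its exact tail.\<close>

lemma sum_scale_levels: "(\<Sum>i\<le>M. width_scale i * (5 + real i)) \<le> 96"
proof -
  have "(\<Sum>i\<le>M. width_scale i * (5 + real i)) = 96 - 8 * (7 + real M) / 2 ^ M"
    by (induction M) (simp_all add: width_scale_def field_simps)
  then show ?thesis by simp
qed

lemma sum_loss_le:
  assumes d: "d \<ge> 1" and inst: "valid_instance d s b x"
  shows "(\<Sum>t<T. loss d s b x t) \<le> 768 / ln (4 / 3) * real d * ln (real d + 1)"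
proof -
  define h where "h = history d (trade_policy d) s b x"
  define L where "L t = level d (h t) (x t)" for t
  \<comment> \<open>Any finite bound on the levels of the first \<open>T\<close> rounds would do,
    since the final estimate is independent of \<open>M\<close>.\<close>
  define M where "M = (\<Sum>t<T. L t)"
  define c :: real where "c = ln (4 / 3)"
  have c: "c > 0" by (simp add: c_def)
  have dec: "0 \<le> log_vol d (h t) i - log_vol d (h (Suc t)) i" for t i
    using log_vol_history_le[OF d inst, of "trade_policy d" t i] by (simp add: h_def)
  \<comment> \<open>A round is paid for by its own level alone. Adding the nonnegative decreases of
    all other scales makes the bound uniform in the level, so the two sums can be exchanged and
    telescoped over time.\<close>
  have step: "loss d s b x t \<le> (\<Sum>i\<le>M. 4 * width_scale i / c * (log_vol d (h t) i - log_vol d (h (Suc t)) i))"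
    if "t < T" for t
  proof -
    let ?f = "\<lambda>i. 4 * width_scale i / c * (log_vol d (h t) i - log_vol d (h (Suc t)) i)"
    have nn: "0 \<le> ?f i" for i
      using dec[of t i] c width_scale_pos[of i] by (intro mult_nonneg_nonneg) auto
    consider "loss d s b x t \<le> 0"
      | "loss d s b x t \<le> 4 * width_scale (L t)" "c \<le> log_vol d (h t) (L t) - log_vol d (h (Suc t)) (L t)"
      using loss_le_log_vol_decrease[OF d inst, of t, folded h_def] by (auto simp: L_def Let_def c_def)
    then show ?thesis
    proof cases
      case 1
      then show ?thesis using sum_nonneg[of "{..M}" ?f] nn by force
    next
      case 2
      have "L t \<le> M" unfolding M_def using that by (intro member_le_sum) auto
      have "loss d s b x t \<le> 4 * width_scale (L t) / c * c" using 2 c by simp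
      also have "\<dots> \<le> ?f (L t)" using 2 c width_scale_pos[of "L t"] by (intro mult_left_mono) auto
      also have "\<dots> \<le> sum ?f {..M}" using \<open>L t \<le> M\<close> nn by (intro member_le_sum) auto
      finally show ?thesis .
    qed
  qed
  have h0: "h 0 = []" by (simp add: h_def)
  have "(\<Sum>t<T. loss d s b x t)
      \<le> (\<Sum>t<T. \<Sum>i\<le>M. 4 * width_scale i / c * (log_vol d (h t) i - log_vol d (h (Suc t)) i))"
    by (rule sum_mono) (use step in auto)
  also have "\<dots> = (\<Sum>i\<le>M. 4 * width_scale i / c * (\<Sum>t<T. log_vol d (h t) i - log_vol d (h (Suc t)) i))"
    by (subst sum.swap) (simp add: sum_distrib_left)
  also have "\<dots> = (\<Sum>i\<le>M. 4 * width_scale i / c * (log_vol d [] i - log_vol d (h T) i))"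
    using sum_lessThan_telescope'[of "\<lambda>t. log_vol d (h t) i" T for i] h0 by simp
  also have "\<dots> \<le> (\<Sum>i\<le>M. 4 * width_scale i / c * (2 * real d * ln (real d + 1) * (5 + real i)))"
    unfolding h_def using c width_scale_pos
    by (intro sum_mono mult_left_mono log_vol_total_decrease_le[OF d inst]) (simp add: less_imp_le)
  \<comment> \<open>The 8 is 4 (loss per width) times 2 (two parties); with the series value 96 it
    gives 768.\<close>
  also have "\<dots> = 8 * real d * ln (real d + 1) / c * (\<Sum>i\<le>M. width_scale i * (5 + real i))"
    unfolding sum_distrib_left by (intro sum.cong refl) (simp add: ac_simps)
  also have "\<dots> \<le> 8 * real d * ln (real d + 1) / c * 96"
    using c by (intro mult_left_mono sum_scale_levels) auto
  finally show ?thesis by (simp add: c_def)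
qed

theorem theorem4p2:
  shows "\<exists>C::real. \<forall>d::nat. d \<ge> 1 \<longrightarrow> (\<exists>A::policy pmf. budget_balanced d A \<and>
           (\<forall>T s b x. valid_instance d s b x \<longrightarrow>
              regret_T d A s b x T \<le> C * real d * ln (real d + 1)))"
proof (intro exI[of _ "768 / ln (4 / 3)"] allI impI)
  fix d :: nat assume d: "d \<ge> 1"
  show "\<exists>A. budget_balanced d A \<and> (\<forall>T s b x. valid_instance d s b x \<longrightarrow>
      regret_T d A s b x T \<le> 768 / ln (4 / 3) * real d * ln (real d + 1))"
  proof (intro exI[of _ "return_pmf (trade_policy d)"] conjI allI impI)
    show "budget_balanced d (return_pmf (trade_policy d))"
      by (simp add: budget_balanced_def prices_def trade_policy_def)
    fix T s b x assume inst: "valid_instance d s b x"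
    have "regret_T d (return_pmf (trade_policy d)) s b x T = (\<Sum>t<T. loss d s b x t)"
      by (simp add: regret_T_def opt_gft_def total_gft_def loss_def sum_subtractf)
    then show "regret_T d (return_pmf (trade_policy d)) s b x T \<le> 768 / ln (4 / 3) * real d * ln (real d + 1)"
      using sum_loss_le[OF d inst] by simp
  qed
qed

end
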